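(* Let $\Phi:\mathbb{R}\to\mathbb{R}$ be a smooth function of moderate growth (so that the expectations below are well defined) with $\Phi(0)=0$, let $h\in\mathbb{R}$, $\sigma>0$, and let $z$ be a standard Gaussian random variable. If $\Phi$ is convex and symmetric (i.e. $\Phi(-x)=\Phi(x)$ for all $x$), then the function $$f(m)=\frac{1}{m}\log\mathbb{E}\exp\big(m\,\Phi(h+\sigma z)\big),\qquad m\ge 0,$$ (with $f(0)=\mathbb{E}\,\Phi(h+\sigma z)$) is convex in $m$.
   Context: The parameter $m$ is not restricted to $[0,1]$. The value at $m=0$ is defined by continuity. "Moderate growth" of $\Phi$ means only that all the expectations (integrals) appearing are well defined. *)

theory Defs
  imports "HOL-Probability.Probability"
begin

definition smooth :: "(real \<Rightarrow> real) \<Rightarrow> bool" where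
  "smooth \<Phi> \<longleftrightarrow> (\<forall>n. (deriv ^^ n) \<Phi> differentiable_on UNIV)"

(* Bochner integrals of non-integrable functions are 0, so "the expectations are well
   defined" has to be stated as integrability. *)
definition moderate_growth ::
    "'a measure \<Rightarrow> ('a \<Rightarrow> real) \<Rightarrow> (real \<Rightarrow> real) \<Rightarrow> real \<Rightarrow> real \<Rightarrow> bool" where
  "moderate_growth M z \<Phi> h \<sigma> \<longleftrightarrow>
     integrable M (\<lambda>\<omega>. \<Phi> (h + \<sigma> * z \<omega>)) \<and>
     (\<forall>m\<ge>0. integrable M (\<lambda>\<omega>. exp (m * \<Phi> (h + \<sigma> * z \<omega>))))"

definition log_exp_mean ::
    "'a measure \<Rightarrow> ('a \<Rightarrow> real) \<Rightarrow> (real \<Rightarrow> real) \<Rightarrow> real \<Rightarrow> real \<Rightarrow> real \<Rightarrow> real" where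
  "log_exp_mean M z \<Phi> h \<sigma> m =
     (if m = 0 then prob_space.expectation M (\<lambda>\<omega>. \<Phi> (h + \<sigma> * z \<omega>))
      else 1 / m * ln (prob_space.expectation M (\<lambda>\<omega>. exp (m * \<Phi> (h + \<sigma> * z \<omega>)))))"

end

theory Submission
  imports Defs "HOL-Real_Asymp.Real_Asymp"
begin

text \<open>Writing \<open>f m = K m / m\<close>, one has \<open>m\<^sup>3 f'' = m\<^sup>2 K'' - 2 (m K' - K)\<close>, so the claim says that under
  the Gaussian law tilted by \<open>exp G\<close>, \<open>G = m \<Phi>\<close>, the variance of \<open>G\<close> is at least twice the relative
  entropy of the tilted law. The Gaussian variable is replaced by a simple random walk on a fine
  lattice, along which variance and entropy can be computed step by step: a step at a site
  where \<open>u = ln (mean of exp G)\<close> has slope \<open>d\<close> and the entropy \<open>v\<close> has slope \<open>w\<close> contributes about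
  \<open>(d + w)\<^sup>2\<close> to the variance and \<open>d\<^sup>2\<close> to twice the entropy, up to \<open>d\<^sup>4\<close>. For even convex \<open>G\<close> both
  \<open>u\<close> and \<open>v\<close> increase away from the origin, so \<open>d\<close> and \<open>w\<close> have equal signs and the variance wins.
  If \<open>G\<close> is Lipschitz, \<open>n\<close> steps of size of order \<open>n powr (-1/2)\<close> accumulate an error of order \<open>1/n\<close>, which
  vanishes in the central limit; a general \<open>\<Phi>\<close> is the increasing limit of Lipschitz ones,
  namely suprema of its tangents.\<close>

section \<open>The binary step\<close>

text \<open>The relative entropy, with respect to a fair coin, of a coin with success probability
  \<open>(1 + tanh d) / 2\<close>.\<close>

definition coin_entropy :: "real \<Rightarrow> real" where
  "coin_entropy d = d * tanh d - ln (cosh d)"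

lemma has_real_derivative_coin_entropy:
  "(coin_entropy has_real_derivative d * (1 - tanh d ^ 2)) (at d)"
proof -
  have "((\<lambda>d. d * tanh d - ln (cosh d)) has_real_derivative d * (1 - tanh d ^ 2)) (at d)"
    by (auto intro!: derivative_eq_intros simp: tanh_def field_simps power2_eq_square)
  then show ?thesis
    by (simp add: coin_entropy_def[abs_def])
qed

lemma tanh_square_le_1: "tanh (x::real) ^ 2 \<le> 1"
  using tanh_real_lt_1[of x] tanh_real_gt_neg1[of x] by (simp add: abs_square_le_1 abs_le_iff)

lemma coin_entropy_mono:
  assumes "0 \<le> x" "x \<le> y"
  shows "coin_entropy x \<le> coin_entropy y"
proof (rule DERIV_nonneg_imp_nondecreasing[OF assms(2)])
  fix t assume "x \<le> t" "t \<le> y"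
  then have "0 \<le> t * (1 - tanh t ^ 2)"
    using assms tanh_square_le_1[of t] by auto
  then show "\<exists>D. (coin_entropy has_real_derivative D) (at t) \<and> 0 \<le> D"
    using has_real_derivative_coin_entropy by blast
qed

lemma coin_entropy_minus [simp]: "coin_entropy (- d) = coin_entropy d"
  by (simp add: coin_entropy_def)

lemma coin_entropy_0 [simp]: "coin_entropy 0 = 0"
  by (simp add: coin_entropy_def)

lemma coin_entropy_le: "2 * coin_entropy d \<le> d ^ 2"
proof -
  have *: "2 * coin_entropy x \<le> x ^ 2" if "0 \<le> x" for x
  proof -
    have "0 ^ 2 - 2 * coin_entropy 0 \<le> x ^ 2 - 2 * coin_entropy x"
    proof (rule DERIV_nonneg_imp_nondecreasing[OF that])
      fix t :: real assume "0 \<le> t" "t \<le> x"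
      have "((\<lambda>x. x ^ 2 - 2 * coin_entropy x) has_real_derivative 2 * t * tanh t ^ 2) (at t)"
        by (auto intro!: derivative_eq_intros has_real_derivative_coin_entropy simp: algebra_simps)
      then show "\<exists>D. ((\<lambda>x. x ^ 2 - 2 * coin_entropy x) has_real_derivative D) (at t) \<and> 0 \<le> D"
        using \<open>0 \<le> t\<close> by (intro exI[of _ "2 * t * tanh t ^ 2"] conjI) auto
    qed
    then show ?thesis by simp
  qed
  show ?thesis
    using *[of d] *[of "- d"] by (cases "0 \<le> d") auto
qed

lemma abs_tanh_le: "\<bar>tanh x\<bar> \<le> \<bar>x::real\<bar>"
proof -
  have *: "tanh x \<le> x" if "0 \<le> x" for x :: real
  proof -
    have "0 - tanh 0 \<le> x - tanh x"
    proof (rule DERIV_nonneg_imp_nondecreasing[OF that])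
      fix t :: real assume "0 \<le> t" "t \<le> x"
      have "((\<lambda>x. x - tanh x) has_real_derivative tanh t ^ 2) (at t)"
        by (auto intro!: derivative_eq_intros)
      then show "\<exists>D. ((\<lambda>x. x - tanh x) has_real_derivative D) (at t) \<and> 0 \<le> D"
        by (intro exI conjI) auto
    qed
    then show ?thesis by simp
  qed
  show ?thesis
    using *[of "\<bar>x\<bar>"] by simp
qed

text \<open>The factor \<open>1 - tanh d ^ 2\<close> is the variance of the tilted coin with values
  1 and -1, so the first term is what a step guarantees for the variance of \<open>G\<close>. Having
  it in place of \<open>d ^ 2\<close> costs \<open>d ^ 2 * tanh d ^ 2\<close>, which is at most
  \<open>d ^ 4\<close>.\<close>

lemma coin_entropy_le_sech:
  "2 * coin_entropy d \<le> d ^ 2 * (1 - tanh d ^ 2) + d ^ 4"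
proof -
  have "tanh d ^ 2 \<le> d ^ 2"
    using abs_tanh_le[of d] by (simp add: abs_le_square_iff)
  then have "d ^ 2 * tanh d ^ 2 \<le> d ^ 2 * d ^ 2"
    by (intro mult_left_mono) auto
  then show ?thesis
    using coin_entropy_le[of d] by (simp add: algebra_simps flip: power_add)
qed

text \<open>For a positive density of the form \<open>exp G\<close> with mass \<open>a\<close> and first two moments
  \<open>b\<close>, \<open>c\<close> of \<open>G\<close>, these are the relative entropy and the variance of \<open>G\<close> after normalisation.\<close>

definition tilted_entropy :: "real \<Rightarrow> real \<Rightarrow> real" where
  "tilted_entropy a b = b / a - ln a"

definition tilted_variance :: "real \<Rightarrow> real \<Rightarrow> real \<Rightarrow> real" where
  "tilted_variance a b c = c / a - (b / a) ^ 2"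

section \<open>Chain rules for entropy and variance over one coin toss\<close>

context
  fixes a1 a2 p d :: real
  assumes pos: "0 < a1" "0 < a2"
    and p: "p = a1 / (a1 + a2)"
    and d: "d = (ln a1 - ln a2) / 2"
begin

text \<open>Law of total expectation: \<open>p\<close> is the probability of the first branch after
  tilting, and \<open>b / a\<close> is the mean of \<open>G\<close> under a tilted law.\<close>

lemma weighted_ratio: "((b1 + b2) / 2) / ((a1 + a2) / 2) = p * (b1 / a1) + (1 - p) * (b2 / a2)"
proof -
  have "1 - p = a2 / (a1 + a2)"
    using pos by (simp add: p field_simps)
  then show ?thesis
    using pos by (simp add: p add_divide_distrib)
qed

text \<open>The odds of the first branch are \<open>a1 / a2\<close>, so \<open>d\<close> is half the
  log-odds and hence the parameter of the tilted coin in \<open>coin_entropy\<close>.\<close>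

lemma tilted_prob_tanh: "2 * p - 1 = tanh d"
proof -
  have "- 2 * d = ln a2 - ln a1"
    by (simp add: d)
  then have "exp (- 2 * d) = a2 / a1"
    using pos by (simp only: exp_diff exp_ln)
  then have "tanh d = (1 - a2 / a1) / (1 + a2 / a1)"
    by (simp only: tanh_real_altdef)
  moreover have "1 - a2 / a1 = (a1 - a2) / a1" "1 + a2 / a1 = (a1 + a2) / a1"
    using pos by (simp_all add: field_simps)
  ultimately have "tanh d = (a1 - a2) / (a1 + a2)"
    using pos by simp
  then show ?thesis
    using pos by (simp add: p field_simps)
qed

lemma ln_mean: "ln ((a1 + a2) / 2) = (ln a1 + ln a2) / 2 + ln (cosh d)"
proof -
  have *: "ln a1 = (ln a1 + ln a2) / 2 + d" "ln a2 = (ln a1 + ln a2) / 2 - d"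
    by (simp_all add: d field_simps)
  have "a1 = exp ((ln a1 + ln a2) / 2) * exp d" "a2 = exp ((ln a1 + ln a2) / 2) * exp (- d)"
    using pos * by (metis exp_add exp_ln, metis exp_add exp_ln diff_conv_add_uminus)
  then have "(a1 + a2) / 2 = exp ((ln a1 + ln a2) / 2) * cosh d"
    by (simp add: cosh_field_def distrib_left)
  then show ?thesis
    by (simp add: ln_mult)
qed

text \<open>Chain rule for relative entropy: the averaged conditional entropies plus the entropy of
  the coin that chooses the branch.\<close>

lemma tilted_entropy_mean:
  "tilted_entropy ((a1 + a2) / 2) ((b1 + b2) / 2) =
     p * tilted_entropy a1 b1 + (1 - p) * tilted_entropy a2 b2 + coin_entropy d"
proof -
  have "p * ln a1 + (1 - p) * ln a2 = (ln a1 + ln a2) / 2 + (2 * p - 1) * d"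
    by (simp add: d field_simps)
  then show ?thesis
    unfolding tilted_entropy_def coin_entropy_def ln_mean weighted_ratio tilted_prob_tanh
    by (simp add: algebra_simps)
qed

text \<open>Law of total variance: the last term is the variance of the conditional mean of
  \<open>G\<close>.\<close>

lemma tilted_variance_mean:
  "tilted_variance ((a1 + a2) / 2) ((b1 + b2) / 2) ((c1 + c2) / 2) =
     p * tilted_variance a1 b1 c1 + (1 - p) * tilted_variance a2 b2 c2
       + p * (1 - p) * (b1 / a1 - b2 / a2) ^ 2"
  unfolding tilted_variance_def weighted_ratio by algebra

text \<open>Averaging the two bounds with weights \<open>p\<close> and \<open>1 - p\<close> keeps
  the error \<open>e\<close>. What remains is to set the variance of the conditional means against
  the entropy of the coin; \<open>sgn\<close> makes the cross term of the former
  nonnegative.\<close>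

lemma tilted_defect_mean:
  assumes V1: "2 * tilted_entropy a1 b1 - e \<le> tilted_variance a1 b1 c1"
    and V2: "2 * tilted_entropy a2 b2 - e \<le> tilted_variance a2 b2 c2"
    and sgn: "0 \<le> d * (tilted_entropy a1 b1 - tilted_entropy a2 b2)"
  shows "2 * tilted_entropy ((a1 + a2) / 2) ((b1 + b2) / 2) - (e + d ^ 4)
    \<le> tilted_variance ((a1 + a2) / 2) ((b1 + b2) / 2) ((c1 + c2) / 2)"
proof -
  define w where "w = tilted_entropy a1 b1 - tilted_entropy a2 b2"
  have p01: "0 \<le> p" "0 \<le> 1 - p"
    using pos by (simp_all add: p field_simps)
  \<comment> \<open>Each conditional mean splits as
    \<open>b / a = tilted_entropy a b + ln a\<close>.\<close>
  have "b1 / a1 - b2 / a2 = 2 * d + w"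
    by (simp add: w_def d tilted_entropy_def field_simps)
  then have "(b1 / a1 - b2 / a2) ^ 2 = 4 * d ^ 2 + 4 * (d * w) + w ^ 2"
    by (simp add: power2_eq_square algebra_simps)
  then have "4 * d ^ 2 \<le> (b1 / a1 - b2 / a2) ^ 2"
    using sgn by (simp add: w_def)
  then have "p * (1 - p) * (4 * d ^ 2) \<le> p * (1 - p) * (b1 / a1 - b2 / a2) ^ 2"
    using p01 by (intro mult_left_mono) auto
  moreover have "p * (1 - p) * (4 * d ^ 2) = d ^ 2 * (1 - tanh d ^ 2)"
    unfolding tilted_prob_tanh[symmetric] by algebra
  moreover have "p * (2 * tilted_entropy a1 b1 - e) \<le> p * tilted_variance a1 b1 c1"
    "(1 - p) * (2 * tilted_entropy a2 b2 - e) \<le> (1 - p) * tilted_variance a2 b2 c2"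
    using V1 V2 p01 by (auto intro!: mult_left_mono)
  ultimately show ?thesis
    unfolding tilted_variance_mean tilted_entropy_mean
    using coin_entropy_le_sech[of d] by (simp add: algebra_simps)
qed

end

section \<open>Means along the simple random walk\<close>

text \<open>The values lie in a general real vector space so that complex characters can be averaged
  as well.\<close>

primrec walk_mean :: "nat \<Rightarrow> (int \<Rightarrow> 'b::real_vector) \<Rightarrow> int \<Rightarrow> 'b" where
  "walk_mean 0 g j = g j"
| "walk_mean (Suc n) g j = (walk_mean n g (j + 1) + walk_mean n g (j - 1)) /\<^sub>R 2"

lemma walk_mean_pos: "(\<And>j. 0 < g j) \<Longrightarrow> 0 < walk_mean n g j" for g :: "int \<Rightarrow> real"
  by (induction n arbitrary: j) (auto intro: add_pos_pos)

lemma walk_mean_minus: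
  "(\<And>j. g (- j) = g j) \<Longrightarrow> walk_mean n g (- j) = walk_mean n g j"
proof (induction n arbitrary: j)
  case (Suc n)
  have "- j + 1 = - (j - 1)" "- j - 1 = - (j + 1)"
    by auto
  with Suc show ?case
    by (simp only: walk_mean.simps add.commute)
qed simp

lemma walk_mean_add: "walk_mean n (\<lambda>i. f i + g i) j = walk_mean n f j + walk_mean n g j"
  by (induction n arbitrary: j) (auto simp: algebra_simps)

lemma walk_mean_mono:
  fixes f g :: "int \<Rightarrow> real"
  shows "(\<And>i. f i \<le> g i) \<Longrightarrow> walk_mean n f j \<le> walk_mean n g j"
  by (induction n arbitrary: j) (auto intro: add_mono)

lemma walk_mean_le_mult_shift:
  fixes g :: "int \<Rightarrow> real"
  shows "(\<And>i. g i \<le> C * g (i + s)) \<Longrightarrow> walk_mean n g j \<le> C * walk_mean n g (j + s)"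
proof (induction n arbitrary: j)
  case (Suc n)
  show ?case
    using Suc.IH[of "j + 1"] Suc.IH[of "j - 1"] Suc.prems
    by (simp add: algebra_simps)
qed simp

text \<open>Sums of log-convex sequences are log-convex, and a step of the walk adds two shifts of
  the same sequence.\<close>

lemma walk_mean_log_convex:
  fixes g :: "int \<Rightarrow> real"
  assumes "\<And>j. 0 < g j" "\<And>j. g j ^ 2 \<le> g (j + 1) * g (j - 1)"
  shows "walk_mean n g j ^ 2 \<le> walk_mean n g (j + 1) * walk_mean n g (j - 1)"
proof (induction n arbitrary: j)
  case 0
  show ?case using assms by simp
next
  case (Suc n)
  let ?w = "walk_mean n g"
  have pos: "0 < ?w i" for i
    using assms(1) by (rule walk_mean_pos)
  have 1: "?w (j + 1) ^ 2 \<le> ?w (j + 2) * ?w j" and 2: "?w (j - 1) ^ 2 \<le> ?w j * ?w (j - 2)"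
    using Suc.IH[of "j + 1"] Suc.IH[of "j - 1"] by (simp_all add: algebra_simps)
  \<comment> \<open>The squares in the expanded claim are bounded by \<open>1\<close> and
    \<open>2\<close>. For the cross term, their product is combined with the arithmetic-geometric
    mean inequality.\<close>
  have "?w (j + 1) ^ 2 * ?w (j - 1) ^ 2 \<le> (?w (j + 2) * ?w j) * (?w j * ?w (j - 2))"
    using 1 2 pos by (intro mult_mono) (auto intro: less_imp_le)
  then have "(?w (j + 1) * ?w (j - 1)) ^ 2 \<le> ?w j ^ 2 * (?w (j + 2) * ?w (j - 2))"
    by (simp add: power_mult_distrib power2_eq_square mult_ac)
  also have "4 * \<dots> \<le> (?w j ^ 2 + ?w (j + 2) * ?w (j - 2)) ^ 2"
    using sum_squares_bound[of "?w j ^ 2" "?w (j + 2) * ?w (j - 2)"]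
    by (simp add: power2_sum mult_ac)
  finally have "(2 * (?w (j + 1) * ?w (j - 1))) ^ 2 \<le> (?w j ^ 2 + ?w (j + 2) * ?w (j - 2)) ^ 2"
    by (simp add: power_mult_distrib)
  then have "2 * (?w (j + 1) * ?w (j - 1)) \<le> ?w j ^ 2 + ?w (j + 2) * ?w (j - 2)"
    by (rule power2_le_imp_le) (simp add: pos less_imp_le)
  with 1 2 have "(?w (j + 1) + ?w (j - 1)) ^ 2 \<le> (?w (j + 2) + ?w j) * (?w j + ?w (j - 2))"
    by (simp add: power2_eq_square algebra_simps)
  then show ?case
    by (simp add: power2_eq_square algebra_simps)
qed

text \<open>The constant \<epsilon> bounds the increment over one lattice site, so it already
  contains the mesh width.\<close>

locale even_convex_lipschitz =
  fixes G :: "int \<Rightarrow> real" and \<epsilon> :: real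
  assumes even: "G (- j) = G j"
    and convex: "2 * G j \<le> G (j + 1) + G (j - 1)"
    and lipschitz: "\<bar>G (j + 1) - G j\<bar> \<le> \<epsilon>"
begin

definition "mass n j = walk_mean n (\<lambda>i. exp (G i)) j"
definition "moment1 n j = walk_mean n (\<lambda>i. G i * exp (G i)) j"
definition "moment2 n j = walk_mean n (\<lambda>i. G i ^ 2 * exp (G i)) j"
definition "entropy n j = tilted_entropy (mass n j) (moment1 n j)"
text \<open>This is the \<open>d\<close> of the binary step taken from \<open>j\<close>, whose
  branches are \<open>j + 1\<close> and \<open>j - 1\<close>.\<close>

definition "log_slope n j = (ln (mass n (j + 1)) - ln (mass n (j - 1))) / 2"

lemma mass_pos: "0 < mass n j"
  unfolding mass_def by (rule walk_mean_pos) simp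

lemma moments_Suc:
  "mass (Suc n) j = (mass n (j + 1) + mass n (j - 1)) / 2"
  "moment1 (Suc n) j = (moment1 n (j + 1) + moment1 n (j - 1)) / 2"
  "moment2 (Suc n) j = (moment2 n (j + 1) + moment2 n (j - 1)) / 2"
  by (simp_all add: mass_def moment1_def moment2_def)

lemma mass_minus: "mass n (- j) = mass n j"
  unfolding mass_def by (rule walk_mean_minus) (simp add: even)

lemma moment1_minus: "moment1 n (- j) = moment1 n j"
  unfolding moment1_def by (rule walk_mean_minus) (simp add: even)

lemma entropy_minus: "entropy n (- j) = entropy n j"
  by (simp add: entropy_def mass_minus moment1_minus)

lemma log_slope_minus: "log_slope n (- j) = - log_slope n j"
proof -
  have "- j + 1 = - (j - 1)" "- j - 1 = - (j + 1)"
    by auto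
  then show ?thesis
    by (simp only: log_slope_def mass_minus) (simp add: field_simps)
qed

text \<open>Convexity of \<open>G\<close> makes \<open>exp G\<close> log-convex, and walk means
  preserve log-convexity.\<close>

lemma ln_mass_convex: "2 * ln (mass n j) \<le> ln (mass n (j + 1)) + ln (mass n (j - 1))"
proof -
  have "mass n j ^ 2 \<le> mass n (j + 1) * mass n (j - 1)"
    unfolding mass_def using convex
    by (intro walk_mean_log_convex) (simp_all flip: exp_add exp_of_nat_mult add: power2_eq_square)
  then have "ln (mass n j ^ 2) \<le> ln (mass n (j + 1) * mass n (j - 1))"
    using mass_pos[of n j] mass_pos[of n "j + 1"] mass_pos[of n "j - 1"] by (intro ln_mono) auto
  then show ?thesis
    using mass_pos[of n j] mass_pos[of n "j + 1"] mass_pos[of n "j - 1"]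
    by (simp add: ln_mult ln_realpow)
qed

lemma log_slope_mono: "i \<le> j \<Longrightarrow> log_slope n i \<le> log_slope n j"
proof (induction rule: int_ge_induct)
  case (step j)
  have "log_slope n j \<le> log_slope n (j + 1)"
    using ln_mass_convex[of n j] ln_mass_convex[of n "j + 1"]
    by (simp add: log_slope_def)
  with step show ?case by simp
qed simp

text \<open>The slope is odd and increasing in the site.\<close>

lemma log_slope_nonneg: "0 \<le> j \<Longrightarrow> 0 \<le> log_slope n j"
  using log_slope_mono[of "- j" j n] by (simp add: log_slope_minus)

text \<open>Shifting by one site changes \<open>exp G\<close>, and therefore its walk means, by a
  factor of at most \<open>exp \<epsilon>\<close> either way. The slope is the average of two such
  logarithmic increments.\<close>

lemma log_slope_le: "\<bar>log_slope n j\<bar> \<le> \<epsilon>"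
proof -
  have *: "\<bar>ln (mass n (i + 1)) - ln (mass n i)\<bar> \<le> \<epsilon>" for i
  proof -
    have "mass n i \<le> exp \<epsilon> * mass n (i + 1)"
      unfolding mass_def
    proof (rule walk_mean_le_mult_shift)
      show "exp (G i) \<le> exp \<epsilon> * exp (G (i + 1))" for i
        using lipschitz[of i] by (simp flip: exp_add)
    qed
    moreover have "mass n (i + 1) \<le> exp \<epsilon> * mass n (i + 1 + - 1)"
      unfolding mass_def
    proof (rule walk_mean_le_mult_shift)
      show "exp (G i) \<le> exp \<epsilon> * exp (G (i + - 1))" for i
        using lipschitz[of "i - 1"] by (simp flip: exp_add)
    qed
    ultimately have "ln (mass n i) \<le> ln (exp \<epsilon> * mass n (i + 1))"
      "ln (mass n (i + 1)) \<le> ln (exp \<epsilon> * mass n i)"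
      using mass_pos by simp_all
    then show ?thesis
      using mass_pos[of n i] mass_pos[of n "i + 1"] by (simp add: ln_mult)
  qed
  show ?thesis
    using *[of j] *[of "j - 1"] by (simp add: log_slope_def)
qed

lemma entropy_Suc:
  "\<exists>p. 0 \<le> p \<and> p \<le> 1 \<and> entropy (Suc n) j =
     p * entropy n (j + 1) + (1 - p) * entropy n (j - 1) + coin_entropy (log_slope n j)"
proof (intro exI conjI)
  let ?p = "mass n (j + 1) / (mass n (j + 1) + mass n (j - 1))"
  show "entropy (Suc n) j =
      ?p * entropy n (j + 1) + (1 - ?p) * entropy n (j - 1) + coin_entropy (log_slope n j)"
    unfolding entropy_def moments_Suc log_slope_def
    by (rule tilted_entropy_mean[OF mass_pos mass_pos refl refl])
  show "0 \<le> ?p" "?p \<le> 1"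
    using mass_pos[of n "j + 1"] mass_pos[of n "j - 1"] by simp_all
qed

text \<open>The reflected walk preserves parity, so the entropy can only be compared across two sites.\<close>

lemma entropy_mono2: "- 1 \<le> j \<Longrightarrow> entropy n j \<le> entropy n (j + 2)"
proof (induction n arbitrary: j)
  case 0
  have G_mono: "G i \<le> G (i + 2)" if "- 1 \<le> i" for i
  proof -
    have "0 \<le> log_slope 0 (i + 1)"
      using that by (intro log_slope_nonneg) simp
    then show ?thesis by (simp add: log_slope_def mass_def add.commute)
  qed
  \<comment> \<open>At time 0 the tilted law is a point mass, so the entropy vanishes at every
    site.\<close>
  show ?case
    by (simp add: entropy_def tilted_entropy_def mass_def moment1_def)
next
  case (Suc n)
  show ?case
  proof (cases "j = - 1")
    \<comment> \<open>The sites -1 and 1 are mirror images, so their entropies agree.\<close>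
    case True
    then show ?thesis
      using entropy_minus[of "Suc n" 1] by simp
  next
    case False
    with Suc.prems have "0 \<le> j" by simp
    obtain p where p: "0 \<le> p" "p \<le> 1" "entropy (Suc n) j =
        p * entropy n (j + 1) + (1 - p) * entropy n (j - 1) + coin_entropy (log_slope n j)"
      using entropy_Suc by blast
    obtain q where q: "0 \<le> q" "q \<le> 1" "entropy (Suc n) (j + 2) =
        q * entropy n (j + 3) + (1 - q) * entropy n (j + 1) + coin_entropy (log_slope n (j + 2))"
      using entropy_Suc[of n "j + 2"] by (auto simp: algebra_simps)
    \<comment> \<open>The value at \<open>n\<close> and \<open>j + 1\<close> separates the two
      mixtures whatever \<open>p\<close> and \<open>q\<close> are: the one for \<open>j\<close> lies
      below it, the one for \<open>j + 2\<close> above it.\<close>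
    have "entropy n (j - 1) \<le> entropy n (j + 1)" "entropy n (j + 1) \<le> entropy n (j + 3)"
      using Suc.IH[of "j - 1"] Suc.IH[of "j + 1"] \<open>0 \<le> j\<close> by (simp_all add: algebra_simps)
    then have "(1 - p) * entropy n (j - 1) \<le> (1 - p) * entropy n (j + 1)"
      "q * entropy n (j + 1) \<le> q * entropy n (j + 3)"
      using p q by (auto intro: mult_left_mono)
    moreover have "coin_entropy (log_slope n j) \<le> coin_entropy (log_slope n (j + 2))"
      using \<open>0 \<le> j\<close> by (intro coin_entropy_mono log_slope_nonneg log_slope_mono) auto
    ultimately show ?thesis
      unfolding p(3) q(3) by (simp add: algebra_simps)
  qed
qed

text \<open>Both factors are odd in \<open>j\<close>, so the product is even; for
  \<open>0 \<le> j\<close> both are nonnegative. This is the sign condition of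
  \<open>tilted_defect_mean\<close>.\<close>

lemma log_slope_entropy_nonneg:
  "0 \<le> log_slope n j * (entropy n (j + 1) - entropy n (j - 1))"
proof -
  have *: "0 \<le> log_slope n i * (entropy n (i + 1) - entropy n (i - 1))" if "0 \<le> i" for i
    using entropy_mono2[of "i - 1" n] log_slope_nonneg[OF that, of n] that
    by (intro mult_nonneg_nonneg) (auto simp: algebra_simps)
  have "- j + 1 = - (j - 1)" "- j - 1 = - (j + 1)"
    by auto
  then have "log_slope n (- j) * (entropy n (- j + 1) - entropy n (- j - 1)) =
      log_slope n j * (entropy n (j + 1) - entropy n (j - 1))"
    by (simp only: log_slope_minus entropy_minus) (simp add: algebra_simps)
  with *[of j] *[of "- j"] show ?thesis
    by (cases "0 \<le> j") auto
qed

text \<open>Both sides start from 0 for a point mass, and each step adds at most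
  \<open>log_slope n j ^ 4 \<le> \<epsilon> ^ 4\<close> to the error.\<close>

lemma entropy_le_variance:
  "2 * entropy n j - n * \<epsilon> ^ 4 \<le> tilted_variance (mass n j) (moment1 n j) (moment2 n j)"
proof (induction n arbitrary: j)
  case 0
  show ?case
    by (simp add: entropy_def tilted_entropy_def tilted_variance_def mass_def moment1_def moment2_def)
next
  case (Suc n)
  have "2 * entropy (Suc n) j - (n * \<epsilon> ^ 4 + log_slope n j ^ 4)
      \<le> tilted_variance (mass (Suc n) j) (moment1 (Suc n) j) (moment2 (Suc n) j)"
    unfolding entropy_def moments_Suc
    using Suc.IH[of "j + 1"] Suc.IH[of "j - 1"] log_slope_entropy_nonneg[of n j]
    by (intro tilted_defect_mean mass_pos refl) (simp_all add: entropy_def log_slope_def)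
  moreover have "log_slope n j ^ 4 \<le> \<epsilon> ^ 4"
    using power_mono[OF log_slope_le abs_ge_zero, of n j 4] by simp
  ultimately show ?case
    by (simp add: algebra_simps)
qed

end

section \<open>Convexity of the logarithmic mean along the walk\<close>

lemma has_real_derivative_walk_mean:
  assumes "\<And>i. ((\<lambda>m. f m i) has_real_derivative f' i) (at m)"
  shows "((\<lambda>m. walk_mean n (f m) j) has_real_derivative walk_mean n f' j) (at m)"
  using assms by (induction n arbitrary: j) (auto intro!: derivative_eq_intros)

lemma walk_mean_mult: "walk_mean n (\<lambda>i. c * g i) j = c * walk_mean n g j" for c :: real
  by (induction n arbitrary: j) (auto simp: algebra_simps)

lemma walk_mean_const [simp]: "walk_mean n (\<lambda>i. c) j = c" for c :: real
  by (induction n arbitrary: j) auto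

section \<open>Convexity under limits\<close>

lemma convex_on_extend_0:
  fixes f :: "real \<Rightarrow> real"
  assumes conv: "convex_on {0<..} f" and lim: "(f \<longlongrightarrow> f 0) (at_right 0)"
  shows "convex_on {0..} f"
proof (rule convex_on_linorderI)
  fix t x y :: real
  assume t: "0 < t" "t < 1" and xy: "x \<in> {0..}" "y \<in> {0..}" "x < y"
  show "f ((1 - t) *\<^sub>R x + t *\<^sub>R y) \<le> (1 - t) * f x + t * f y"
  proof (cases "x = 0")
    case False
    then show ?thesis
      using t xy by (intro convex_onD[OF conv]) auto
  next
    case True
    \<comment> \<open>The inequality for the endpoints \<open>s\<close> and \<open>y\<close> is
      passed to the limit as \<open>s\<close> decreases to 0. The interior point moves with
      \<open>s\<close>, so continuity there is required; convexity on the open half-line supplies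
      it.\<close>
    have "isCont f (t * y)"
      using convex_on_continuous[OF _ conv] t xy True
      by (simp add: continuous_on_eq_continuous_at)
    moreover have "((\<lambda>s. (1 - t) * s + t * y) \<longlongrightarrow> t * y) (at_right 0)"
      by (auto intro!: tendsto_eq_intros)
    ultimately have l: "((\<lambda>s. f ((1 - t) * s + t * y)) \<longlongrightarrow> f (t * y)) (at_right 0)"
      by (rule isCont_tendsto_compose)
    have r: "((\<lambda>s. (1 - t) * f s + t * f y) \<longlongrightarrow> (1 - t) * f 0 + t * f y) (at_right 0)"
      by (intro tendsto_intros lim)
    have "\<forall>\<^sub>F s in at_right 0. f ((1 - t) * s + t * y) \<le> (1 - t) * f s + t * f y"
      using eventually_at_right_less
    proof eventually_elim
      case (elim s)
      then show ?case
        using convex_onD[OF conv, of t s y] t xy True by simp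
    qed
    then have "f (t * y) \<le> (1 - t) * f 0 + t * f y"
      by (intro tendsto_le[OF _ r l]) simp
    with True show ?thesis by simp
  qed
qed simp

lemma convex_on_eqI:
  assumes "convex_on S f" "\<And>x. x \<in> S \<Longrightarrow> f x = g x"
  shows "convex_on S g"
proof (rule convex_onI)
  show S: "convex S"
    using assms(1) by (rule convex_on_imp_convex)
  fix t x y
  assume "(0::real) < t" "t < 1" "x \<in> S" "y \<in> S"
  moreover from this have "(1 - t) *\<^sub>R x + t *\<^sub>R y \<in> S"
    using S by (simp add: convexD)
  ultimately show "g ((1 - t) *\<^sub>R x + t *\<^sub>R y) \<le> (1 - t) * g x + t * g y"
    using convex_onD[OF assms(1), of t x y] by (simp add: assms(2))
qed

lemma convex_on_tendsto:
  fixes f :: "nat \<Rightarrow> 'a::real_vector \<Rightarrow> real"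
  assumes "\<And>n. convex_on S (f n)" "\<And>x. x \<in> S \<Longrightarrow> (\<lambda>n. f n x) \<longlonglongrightarrow> g x"
  shows "convex_on S g"
proof (rule convex_onI)
  show "convex S"
    using assms(1) by (rule convex_on_imp_convex)
  fix t x y
  assume t: "(0::real) < t" "t < 1" and xy: "x \<in> S" "y \<in> S"
  then have "(1 - t) *\<^sub>R x + t *\<^sub>R y \<in> S"
    using \<open>convex S\<close> by (simp add: convexD)
  then have "(\<lambda>n. f n ((1 - t) *\<^sub>R x + t *\<^sub>R y)) \<longlonglongrightarrow> g ((1 - t) *\<^sub>R x + t *\<^sub>R y)"
    by (rule assms(2))
  moreover have "(\<lambda>n. (1 - t) * f n x + t * f n y) \<longlonglongrightarrow> (1 - t) * g x + t * g y"
    using xy by (intro tendsto_intros assms(2))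
  moreover have "f n ((1 - t) *\<^sub>R x + t *\<^sub>R y) \<le> (1 - t) * f n x + t * f n y" for n
    using t xy by (intro convex_onD[OF assms(1)]) auto
  ultimately show "g ((1 - t) *\<^sub>R x + t *\<^sub>R y) \<le> (1 - t) * g x + t * g y"
    by (blast intro: LIMSEQ_le)
qed

definition walk_log_mean :: "nat \<Rightarrow> (int \<Rightarrow> real) \<Rightarrow> int \<Rightarrow> real \<Rightarrow> real" where
  "walk_log_mean n g j m =
     (if m = 0 then walk_mean n g j else 1 / m * ln (walk_mean n (\<lambda>i. exp (m * g i)) j))"

text \<open>For \<open>m > 0\<close>, \<open>m ^ 3\<close> times the second derivative of the
  logarithmic mean is the variance minus twice the entropy for the tilt \<open>m * g\<close>, hence
  at least \<open>- n * (m * \<epsilon>) ^ 4\<close>. The cubic term has second derivative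
  \<open>n * \<epsilon> ^ 4 * m\<close> and compensates for exactly this.\<close>

lemma convex_on_walk_log_mean:
  assumes "even_convex_lipschitz g \<epsilon>"
  shows "convex_on {0..} (\<lambda>m. walk_log_mean n g j m + n * \<epsilon> ^ 4 * m ^ 3 / 6)"
proof (rule convex_on_extend_0)
  \<comment> \<open>\<open>A k\<close> is the \<open>k\<close>-th derivative of the moment
    generating function \<open>A 0\<close>.\<close>
  define A where "A k m = walk_mean n (\<lambda>i. g i ^ k * exp (m * g i)) j" for k :: nat and m
  have A_deriv [derivative_intros]:
    "((\<lambda>m. A k (f m)) has_real_derivative A (Suc k) (f m) * D) (at m)"
    if "(f has_real_derivative D) (at m)" for k f m D
  proof -
    have "(A k has_real_derivative A (Suc k) m) (at m)" for m
      unfolding A_def[abs_def]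
      by (rule has_real_derivative_walk_mean) (auto intro!: derivative_eq_intros)
    then show ?thesis
      using that by (rule DERIV_chain2)
  qed
  have A_pos: "0 < A 0 m" for m
    unfolding A_def by (rule walk_mean_pos) simp
  have A0: "walk_mean n (\<lambda>i. exp (m * g i)) j = A 0 m" for m
    by (simp add: A_def)
  let ?F = "\<lambda>m. ln (A 0 m) / m + n * \<epsilon> ^ 4 * m ^ 3 / 6"
  let ?F' = "\<lambda>m. A 1 m / A 0 m / m - ln (A 0 m) / m ^ 2 + n * \<epsilon> ^ 4 * m ^ 2 / 2"
  let ?F'' = "\<lambda>m. (A 2 m / A 0 m - (A 1 m / A 0 m) ^ 2) / m - 2 * (A 1 m / A 0 m) / m ^ 2
    + 2 * ln (A 0 m) / m ^ 3 + n * \<epsilon> ^ 4 * m"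
  have "convex_on {0<..} ?F"
  proof (rule f''_ge0_imp_convex)
    fix m :: real assume "m \<in> {0<..}"
    then have m: "0 < m" by simp
    note [simp] = A_pos[of m, THEN less_imp_neq, symmetric] A_pos[of m]
    show "(?F has_real_derivative ?F' m) (at m)"
      using m by (auto intro!: derivative_eq_intros simp: field_simps power2_eq_square)
    show "(?F' has_real_derivative ?F'' m) (at m)"
      using m by (auto intro!: derivative_eq_intros simp: field_simps eval_nat_numeral)
    \<comment> \<open>The entropy bound is applied to \<open>m * g\<close>, whose first two tilted
      moments are \<open>m * A 1 m\<close> and \<open>m ^ 2 * A 2 m\<close>.\<close>
    interpret G: even_convex_lipschitz "\<lambda>i. m * g i" "m * \<epsilon>"
    proof -
      interpret even_convex_lipschitz g \<epsilon> by fact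
      show "even_convex_lipschitz (\<lambda>i. m * g i) (m * \<epsilon>)"
      proof
        show "m * g (- i) = m * g i" for i
          by (simp add: even)
        show "2 * (m * g i) \<le> m * g (i + 1) + m * g (i - 1)" for i
          using mult_left_mono[OF convex[of i], of m] m by (simp add: algebra_simps)
        show "\<bar>m * g (i + 1) - m * g i\<bar> \<le> m * \<epsilon>" for i
          using mult_left_mono[OF lipschitz[of i], of m] m
          by (simp add: abs_mult flip: right_diff_distrib)
      qed
    qed
    have "G.mass n j = A 0 m" "G.moment1 n j = m * A 1 m" "G.moment2 n j = m ^ 2 * A 2 m"
      by (simp_all add: G.mass_def G.moment1_def G.moment2_def A_def power_mult_distrib mult.assoc
          walk_mean_mult)
    then have "0 \<le> m ^ 2 * A 2 m / A 0 m - (m * A 1 m / A 0 m) ^ 2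
        - 2 * (m * A 1 m / A 0 m - ln (A 0 m)) + n * (m * \<epsilon>) ^ 4" (is "0 \<le> ?N")
      using G.entropy_le_variance[of n j]
      by (simp add: tilted_entropy_def tilted_variance_def G.entropy_def)
    moreover have "?F'' m = ?N / m ^ 3"
      using m by (simp add: field_simps eval_nat_numeral)
    ultimately show "0 \<le> ?F'' m"
      using m by simp
  qed simp
  then show "convex_on {0<..} (\<lambda>m. walk_log_mean n g j m + n * \<epsilon> ^ 4 * m ^ 3 / 6)"
    by (rule convex_on_eqI) (auto simp: walk_log_mean_def A0)
  \<comment> \<open>Since \<open>A 0 0 = 1\<close>, the quotient \<open>ln (A 0 m) / m\<close> is a
    difference quotient at 0, with limit the mean of \<open>g\<close>.\<close>
  have "((\<lambda>m. ln (A 0 m)) has_real_derivative A 1 0 / A 0 0) (at 0)"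
    using A_pos[of 0] by (auto intro!: derivative_eq_intros)
  then have "((\<lambda>m. ln (A 0 m) / m) \<longlongrightarrow> walk_mean n g j) (at 0)"
    by (simp add: has_field_derivative_iff A_def)
  then have "((\<lambda>m. ln (A 0 m) / m) \<longlongrightarrow> walk_mean n g j) (at_right 0)"
    by (rule filterlim_mono) (auto simp: at_le)
  moreover have "\<forall>\<^sub>F m in at_right 0. ln (A 0 m) / m = walk_log_mean n g j m"
    using eventually_at_right_less
    by eventually_elim (simp add: walk_log_mean_def A0)
  ultimately have "(walk_log_mean n g j \<longlongrightarrow> walk_mean n g j) (at_right 0)"
    by (rule Lim_transform_eventually)
  moreover have "((\<lambda>m. n * \<epsilon> ^ 4 * m ^ 3 / 6) \<longlongrightarrow> n * \<epsilon> ^ 4 * 0 ^ 3 / 6) (at_right 0)"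
    by (intro tendsto_intros) auto
  ultimately show "((\<lambda>m. walk_log_mean n g j m + n * \<epsilon> ^ 4 * m ^ 3 / 6) \<longlongrightarrow>
      walk_log_mean n g j 0 + n * \<epsilon> ^ 4 * 0 ^ 3 / 6) (at_right 0)"
    unfolding walk_log_mean_def[of n g j 0] if_P[OF refl] by (rule tendsto_add)
qed

section \<open>Convergence of the walk to the Gaussian law\<close>

text \<open>The law of the walk as a measure, which weak convergence needs. The first step is split
  off as in \<open>walk_mean\<close>.\<close>

primrec walk_pmf :: "nat \<Rightarrow> int \<Rightarrow> int pmf" where
  "walk_pmf 0 j = return_pmf j"
| "walk_pmf (Suc n) j = pmf_of_set {j + 1, j - 1} \<bind> walk_pmf n"

lemma finite_set_walk_pmf [simp]: "finite (set_pmf (walk_pmf n j))"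
  by (induction n arbitrary: j) (auto simp: set_bind_pmf)

lemma expectation_walk_pmf:
  fixes f :: "int \<Rightarrow> 'b::{banach, second_countable_topology}"
  shows "measure_pmf.expectation (walk_pmf n j) f = walk_mean n f j"
  by (induction n arbitrary: j)
    (auto simp: pmf_expectation_bind_pmf_of_set scaleR_add_right)

text \<open>Characters are eigenfunctions of the averaging step with eigenvalue
  \<open>cos s\<close>; this gives the characteristic function of the walk.\<close>

lemma walk_mean_cis:
  "walk_mean n (\<lambda>i. cis (s * real_of_int i)) j = of_real (cos s ^ n) * cis (s * j)"
proof (induction n arbitrary: j)
  case (Suc n)
  have "cis (s * real_of_int (j + 1)) + cis (s * real_of_int (j - 1)) = of_real (2 * cos s) * cis (s * j)"
    by (simp add: complex_eq_iff distrib_left right_diff_distrib cos_add cos_diff sin_add sin_diff)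
  then show ?case
    by (simp only: walk_mean.simps Suc.IH flip: distrib_left) (simp add: scaleR_conv_of_real)
qed simp

lemma walk_mean_exp:
  "walk_mean n (\<lambda>i. exp (\<alpha> * real_of_int i)) j = cosh \<alpha> ^ n * exp (\<alpha> * j)"
proof (induction n arbitrary: j)
  case (Suc n)
  show ?case
    by (simp add: Suc.IH cosh_field_def algebra_simps exp_add exp_diff exp_minus)
       (simp add: field_simps)
qed simp

text \<open>Nonnegativity of \<open>coin_entropy\<close> gives
  \<open>ln (cosh x) \<le> x * tanh x\<close>, and
  \<open>\<bar>tanh x\<bar> \<le> \<bar>x\<bar>\<close>.\<close>

lemma cosh_le_exp_square: "cosh x \<le> exp (x ^ 2)" for x :: real
proof -
  have "0 \<le> coin_entropy x"
    using coin_entropy_mono[of 0 "\<bar>x\<bar>"] by (cases "0 \<le> x") auto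
  moreover have "x * tanh x \<le> \<bar>x\<bar> * \<bar>tanh x\<bar>"
    by (metis abs_ge_self abs_mult)
  moreover have "\<bar>x\<bar> * \<bar>tanh x\<bar> \<le> \<bar>x\<bar> * \<bar>x\<bar>"
    by (intro mult_left_mono abs_tanh_le) simp
  ultimately have "ln (cosh x) \<le> x ^ 2"
    by (simp add: coin_entropy_def power2_eq_square)
  then show ?thesis
    by (metis cosh_real_pos exp_le_cancel_iff exp_ln)
qed

text \<open>The bound stays uniform when \<open>n * \<alpha> ^ 2\<close> and
  \<open>\<alpha> * j\<close> are bounded, as they are under diffusive scaling.\<close>

lemma walk_mean_exp_abs_le:
  "walk_mean n (\<lambda>i. exp (\<alpha> * \<bar>real_of_int i\<bar>)) j \<le> 2 * exp (n * \<alpha> ^ 2 + \<bar>\<alpha> * j\<bar>)"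
proof -
  have "walk_mean n (\<lambda>i. exp (\<alpha> * \<bar>real_of_int i\<bar>)) j
      \<le> walk_mean n (\<lambda>i. exp (\<alpha> * real_of_int i) + exp (- \<alpha> * real_of_int i)) j"
    by (rule walk_mean_mono) (auto simp: abs_if)
  also have "\<dots> = cosh \<alpha> ^ n * (exp (\<alpha> * j) + exp (- \<alpha> * j))"
    by (simp only: walk_mean_add walk_mean_exp cosh_minus) (simp add: algebra_simps)
  also have "\<dots> \<le> exp (\<alpha> ^ 2) ^ n * (exp \<bar>\<alpha> * j\<bar> + exp \<bar>\<alpha> * j\<bar>)"
    by (intro mult_mono power_mono add_mono cosh_le_exp_square) auto
  also have "\<dots> = 2 * exp (n * \<alpha> ^ 2 + \<bar>\<alpha> * j\<bar>)"
    by (simp add: exp_add flip: exp_of_nat_mult)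
  finally show ?thesis .
qed

lemma cos_power_tendsto:
  "(\<lambda>n. cos (s / sqrt (real (Suc n))) ^ Suc n) \<longlonglongrightarrow> exp (- (s\<^sup>2) / 2)"
proof (cases "s = 0")
  case False
  \<comment> \<open>With \<open>powr\<close> the expression is amenable to asymptotic expansion; the
    base is eventually positive, so \<open>powr\<close> and the power then agree.\<close>
  have "(\<lambda>n. cos (s / sqrt (real (Suc n))) powr (real (Suc n))) \<longlonglongrightarrow> exp (- (s\<^sup>2) / 2)"
    using False by (real_asymp simp: power2_eq_square)
  moreover have "\<forall>\<^sub>F n in sequentially. 0 < cos (s / sqrt (real (Suc n)))"
    using False by real_asymp
  then have "\<forall>\<^sub>F n in sequentially. cos (s / sqrt (real (Suc n))) powr (real (Suc n)) =
      cos (s / sqrt (real (Suc n))) ^ Suc n"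
    by eventually_elim (simp only: powr_realpow)
  ultimately show ?thesis
    by (rule Lim_transform_eventually)
qed simp

text \<open>Bounded second moments make \<open>f\<close> uniformly integrable: truncating at
  \<open>K\<close> costs at most \<open>C' / K\<close> under every measure involved, and the
  truncated function is bounded and continuous.\<close>

lemma weak_conv_integral_tendsto:
  fixes f :: "real \<Rightarrow> real"
  assumes \<mu>: "\<And>n. real_distribution (\<mu> n)" and \<nu>: "real_distribution \<nu>"
    and weak: "weak_conv_m \<mu> \<nu>"
    and f: "continuous_on UNIV f" "\<And>x. 0 \<le> f x"
    and int: "\<And>n. integrable (\<mu> n) (\<lambda>x. f x ^ 2)" "integrable \<nu> (\<lambda>x. f x ^ 2)"
    and bnd: "\<And>n. (\<integral>x. f x ^ 2 \<partial>\<mu> n) \<le> C"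
  shows "(\<lambda>n. \<integral>x. f x \<partial>\<mu> n) \<longlonglongrightarrow> (\<integral>x. f x \<partial>\<nu>)"
proof (rule LIMSEQ_I)
  \<comment> \<open>The constant covers the limit measure as well, and the 1 ensures that
    \<open>K\<close> below is positive.\<close>
  define C' where "C' = max 1 (max C (\<integral>x. f x ^ 2 \<partial>\<nu>))"
  have trunc: "\<bar>(\<integral>x. f x \<partial>\<rho>) - (\<integral>x. min (f x) K \<partial>\<rho>)\<bar> \<le> C' / K"
    if \<rho>: "real_distribution \<rho>" "integrable \<rho> (\<lambda>x. f x ^ 2)" "(\<integral>x. f x ^ 2 \<partial>\<rho>) \<le> C'" and "0 < K"
    for \<rho> K
  proof -
    interpret real_distribution \<rho> by fact
    have [measurable]: "f \<in> borel_measurable \<rho>"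
      using borel_measurable_continuous_onI[OF f(1)] by simp
    have i1: "integrable \<rho> f"
      using that(2) by (rule square_integrable_imp_integrable[rotated]) simp
    have i2: "integrable \<rho> (\<lambda>x. min (f x) K)"
      using i1 by (rule Bochner_Integration.integrable_bound) (use f(2) \<open>0 < K\<close> in auto)
    have le: "f x - min (f x) K \<le> f x ^ 2 / K" for x
    proof (cases "f x \<le> K")
      case False
      then have "f x * K \<le> f x * f x"
        using f(2)[of x] by (intro mult_left_mono) auto
      then have "f x \<le> f x ^ 2 / K"
        using \<open>0 < K\<close> by (simp add: field_simps power2_eq_square)
      with \<open>0 < K\<close> show ?thesis by (simp add: min_def)
    qed (use \<open>0 < K\<close> in simp)
    have "(\<integral>x. f x \<partial>\<rho>) - (\<integral>x. min (f x) K \<partial>\<rho>) = (\<integral>x. f x - min (f x) K \<partial>\<rho>)"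
      using i1 i2 by simp
    moreover have "0 \<le> (\<integral>x. f x - min (f x) K \<partial>\<rho>)"
      by (rule integral_nonneg_AE) simp
    moreover have "(\<integral>x. f x - min (f x) K \<partial>\<rho>) \<le> (\<integral>x. f x ^ 2 / K \<partial>\<rho>)"
      using i1 i2 that(2) le by (intro integral_mono) auto
    moreover have "(\<integral>x. f x ^ 2 / K \<partial>\<rho>) \<le> C' / K"
      using that(3) \<open>0 < K\<close> by (simp add: divide_right_mono)
    ultimately show ?thesis by simp
  qed
  fix e :: real assume "0 < e"
  \<comment> \<open>The two truncation errors are then \<open>e / 4\<close> each, leaving
    \<open>e / 2\<close> for the weak convergence.\<close>
  define K where "K = 4 * C' / e"
  have "0 < K" "C' / K = e / 4"
    using \<open>0 < e\<close> by (simp_all add: K_def C'_def)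
  have "(\<lambda>n. \<integral>x. min (f x) K \<partial>\<mu> n) \<longlonglongrightarrow> (\<integral>x. min (f x) K \<partial>\<nu>)"
  proof (rule weak_conv_imp_integral_bdd_continuous_conv[OF \<mu> \<nu> weak])
    have "continuous_on UNIV (\<lambda>x. min (f x) K)"
      by (intro continuous_intros f)
    then show "isCont (\<lambda>x. min (f x) K) x" for x
      by (simp add: continuous_on_eq_continuous_at)
    show "norm (min (f x) K) \<le> K" for x
      using f(2)[of x] \<open>0 < K\<close> by simp
  qed
  from LIMSEQ_D[OF this, of "e / 2"] \<open>0 < e\<close> obtain N where
    N: "\<bar>(\<integral>x. min (f x) K \<partial>\<mu> n) - (\<integral>x. min (f x) K \<partial>\<nu>)\<bar> < e / 2" if "N \<le> n" for n
    by auto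
  have "\<bar>(\<integral>x. f x \<partial>\<mu> n) - (\<integral>x. f x \<partial>\<nu>)\<bar> < e" if "N \<le> n" for n
  proof -
    have "(\<integral>x. f x ^ 2 \<partial>\<mu> n) \<le> C'" "(\<integral>x. f x ^ 2 \<partial>\<nu>) \<le> C'"
      using bnd[of n] by (simp_all add: C'_def)
    then have "\<bar>(\<integral>x. f x \<partial>\<mu> n) - (\<integral>x. min (f x) K \<partial>\<mu> n)\<bar> \<le> e / 4"
      "\<bar>(\<integral>x. f x \<partial>\<nu>) - (\<integral>x. min (f x) K \<partial>\<nu>)\<bar> \<le> e / 4"
      using trunc[OF \<mu> int(1) _ \<open>0 < K\<close>] trunc[OF \<nu> int(2) _ \<open>0 < K\<close>] \<open>C' / K = e / 4\<close>
      by auto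
    then show ?thesis
      using N[OF that] by linarith
  qed
  then show "\<exists>N. \<forall>n\<ge>N. norm ((\<integral>x. f x \<partial>\<mu> n) - (\<integral>x. f x \<partial>\<nu>)) < e"
    by auto
qed

section \<open>Central limit theorem for the rescaled walk\<close>

lemma char_gaussian:
  assumes "prob_space M" "distributed M lborel z std_normal_density"
  shows "char (distr M borel (\<lambda>\<omega>. h + \<sigma> * z \<omega>)) t = of_real (exp (- ((t * \<sigma>)\<^sup>2) / 2)) * cis (t * h)"
proof -
  interpret prob_space M by fact
  have [measurable]: "z \<in> borel_measurable M"
    using distributed_measurable[OF assms(2)] by simp
  have "distr M borel z = distr M lborel z"
    by (rule distr_cong) auto
  also have "\<dots> = std_normal_distribution"
    by (rule distributed_distr_eq_density[OF assms(2)])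
  finally have eq: "distr M borel z = std_normal_distribution" .
  have "char (distr M borel (\<lambda>\<omega>. h + \<sigma> * z \<omega>)) t = (CLINT \<omega>|M. iexp (t * h) * iexp ((t * \<sigma>) * z \<omega>))"
    by (simp add: char_def integral_distr algebra_simps flip: exp_add)
  also have "\<dots> = iexp (t * h) * char (distr M borel z) (t * \<sigma>)"
    by (simp add: char_def integral_distr)
  also have "\<dots> = of_real (exp (- ((t * \<sigma>)\<^sup>2) / 2)) * cis (t * h)"
    by (simp add: eq char_std_normal_distribution cis_conv_exp)
  finally show ?thesis .
qed

text \<open>The walk makes \<open>Suc n\<close> steps of size \<open>\<delta> n\<close>, with total
  variance \<sigma> squared, from the lattice point next below \<open>h\<close>. Characteristic
  functions give weak convergence, and the growth condition extends it to unbounded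
  \<open>f\<close>.\<close>

lemma walk_mean_tendsto_gaussian:
  fixes f :: "real \<Rightarrow> real" and \<sigma> :: real
  assumes M: "prob_space M" "distributed M lborel z std_normal_density" and \<sigma>: "0 < \<sigma>"
    and f: "continuous_on UNIV f" "\<And>x. 0 \<le> f x"
    and growth: "0 \<le> k" "\<And>x. f x ^ 2 \<le> C * exp (k * \<bar>x\<bar>)"
    and int: "integrable M (\<lambda>\<omega>. f (h + \<sigma> * z \<omega>) ^ 2)"
  defines "\<delta> \<equiv> \<lambda>n. \<sigma> / sqrt (real (Suc n))"
  shows "(\<lambda>n. walk_mean (Suc n) (\<lambda>i. f (\<delta> n * real_of_int i)) \<lfloor>h / \<delta> n\<rfloor>)
    \<longlonglongrightarrow> (\<integral>\<omega>. f (h + \<sigma> * z \<omega>) \<partial>M)"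
proof -
  interpret prob_space M by fact
  have z [measurable]: "z \<in> borel_measurable M"
    using distributed_measurable[OF M(2)] by simp
  have f_meas [measurable]: "f \<in> borel_measurable borel"
    using f(1) by (rule borel_measurable_continuous_onI)
  define j where "j n = \<lfloor>h / \<delta> n\<rfloor>" for n
  define \<mu> where "\<mu> n = distr (measure_pmf (walk_pmf (Suc n) (j n))) borel (\<lambda>i. \<delta> n * real_of_int i)" for n
  define \<nu> where "\<nu> = distr M borel (\<lambda>\<omega>. h + \<sigma> * z \<omega>)"
  have \<delta>: "0 < \<delta> n" "\<delta> n \<le> \<sigma>" "real (Suc n) * \<delta> n ^ 2 = \<sigma> ^ 2" for n
    using \<sigma> by (auto simp: \<delta>_def power_divide field_simps)
  have \<delta>_lim: "\<delta> \<longlonglongrightarrow> 0"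
    unfolding \<delta>_def by real_asymp
  have j: "h - \<delta> n \<le> \<delta> n * j n" "\<delta> n * j n \<le> h" for n
  proof -
    have "h / \<delta> n - 1 \<le> j n" "j n \<le> h / \<delta> n"
      unfolding j_def by linarith+
    then show "h - \<delta> n \<le> \<delta> n * j n" "\<delta> n * j n \<le> h"
      using \<delta>(1)[of n] by (simp_all add: field_simps)
  qed
  have j_lim: "(\<lambda>n. \<delta> n * j n) \<longlonglongrightarrow> h"
  proof (rule tendsto_sandwich)
    show "(\<lambda>n. h - \<delta> n) \<longlonglongrightarrow> h"
      using tendsto_diff[OF tendsto_const \<delta>_lim, of h] by simp
  qed (use j in auto)
  have expect: "(\<integral>x. g x \<partial>\<mu> n) = walk_mean (Suc n) (\<lambda>i. g (\<delta> n * real_of_int i)) (j n)"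
    if [measurable]: "g \<in> borel_measurable borel" for n and g :: "real \<Rightarrow> 'b::{banach, second_countable_topology}"
    unfolding \<mu>_def by (subst integral_distr) (simp_all only: expectation_walk_pmf, auto)
  have \<mu>: "real_distribution (\<mu> n)" for n
    unfolding \<mu>_def by (intro prob_space.real_distribution_distr measure_pmf.prob_space_axioms) auto
  have \<nu>: "real_distribution \<nu>"
    unfolding \<nu>_def by (intro real_distribution_distr) auto
  have "weak_conv_m \<mu> \<nu>"
  proof (rule levy_continuity[OF \<mu> \<nu>])
    fix t
    have "char (\<mu> n) t = of_real (cos (t * \<delta> n) ^ Suc n) * cis (t * (\<delta> n * j n))" for n
    proof -
      have "char (\<mu> n) t = walk_mean (Suc n) (\<lambda>i. iexp (t * (\<delta> n * real_of_int i))) (j n)"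
        unfolding char_def by (rule expect) simp
      also have "\<dots> = walk_mean (Suc n) (\<lambda>i. cis ((t * \<delta> n) * real_of_int i)) (j n)"
        by (simp add: cis_conv_exp mult.assoc)
      finally show ?thesis
        using walk_mean_cis[of "Suc n" "t * \<delta> n" "j n"] by (simp only: mult.assoc)
    qed
    moreover have "(\<lambda>n. cos (t * \<delta> n) ^ Suc n) \<longlonglongrightarrow> exp (- ((t * \<sigma>)\<^sup>2) / 2)"
      using cos_power_tendsto[of "t * \<sigma>"] by (simp add: \<delta>_def)
    moreover have "(\<lambda>n. cis (t * (\<delta> n * j n))) \<longlonglongrightarrow> cis (t * h)"
      by (intro tendsto_intros j_lim)
    ultimately show "(\<lambda>n. char (\<mu> n) t) \<longlonglongrightarrow> char \<nu> t"
      unfolding \<nu>_def char_gaussian[OF M] by (simp only: tendsto_mult tendsto_of_real)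
  qed
  then have "(\<lambda>n. \<integral>x. f x \<partial>\<mu> n) \<longlonglongrightarrow> (\<integral>x. f x \<partial>\<nu>)"
  proof (rule weak_conv_integral_tendsto[OF \<mu> \<nu> _ f])
    show "integrable (\<mu> n) (\<lambda>x. f x ^ 2)" for n
      unfolding \<mu>_def by (subst integrable_distr_eq) (auto intro: integrable_measure_pmf_finite)
    show "integrable \<nu> (\<lambda>x. f x ^ 2)"
      unfolding \<nu>_def using int by (subst integrable_distr_eq) auto
    have C: "0 \<le> C"
      using growth(2)[of 0] order_trans[OF zero_le_power2] by fastforce
    fix n
    \<comment> \<open>The resulting bound is independent of \<open>n\<close> because
      \<open>Suc n * \<delta> n ^ 2 = \<sigma> ^ 2\<close> and the starting point is within \<sigma>
      of \<open>h\<close>.\<close>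
    have "(\<integral>x. f x ^ 2 \<partial>\<mu> n) = walk_mean (Suc n) (\<lambda>i. f (\<delta> n * real_of_int i) ^ 2) (j n)"
      by (rule expect) simp
    also have "\<dots> \<le> walk_mean (Suc n) (\<lambda>i. C * exp (k * \<delta> n * \<bar>real_of_int i\<bar>)) (j n)"
    proof (rule walk_mean_mono)
      show "f (\<delta> n * real_of_int i) ^ 2 \<le> C * exp (k * \<delta> n * \<bar>real_of_int i\<bar>)" for i
        using growth(2)[of "\<delta> n * i"] \<delta>(1)[of n] by (simp add: abs_mult mult.assoc)
    qed
    also have "\<dots> \<le> C * (2 * exp (Suc n * (k * \<delta> n) ^ 2 + \<bar>k * \<delta> n * j n\<bar>))"
      unfolding walk_mean_mult using C by (intro mult_left_mono walk_mean_exp_abs_le) auto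
    also have "\<dots> \<le> C * (2 * exp (k ^ 2 * \<sigma> ^ 2 + k * (\<bar>h\<bar> + \<sigma>)))"
    proof -
      have "Suc n * (k * \<delta> n) ^ 2 = k ^ 2 * \<sigma> ^ 2"
        using \<delta>(3)[of n] by (simp only: power_mult_distrib) (metis mult.left_commute)
      moreover have "\<bar>k * \<delta> n * j n\<bar> \<le> k * (\<bar>h\<bar> + \<sigma>)"
        using j[of n] \<delta>(2)[of n] growth(1)
        by (simp only: abs_mult[of k] mult.assoc) (intro mult_mono; auto)
      ultimately show ?thesis
        using C by (intro mult_left_mono) auto
    qed
    finally show "(\<integral>x. f x ^ 2 \<partial>\<mu> n) \<le> C * (2 * exp (k ^ 2 * \<sigma> ^ 2 + k * (\<bar>h\<bar> + \<sigma>)))" .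
  qed
  then show ?thesis
    unfolding expect[OF f_meas] by (simp add: \<nu>_def integral_distr j_def)
qed

section \<open>Lipschitz functions and truncation\<close>

text \<open>Keeps the limit of the expectations away from 0, where \<open>ln\<close> is
  discontinuous.\<close>

lemma expectation_exp_ge_1:
  fixes X :: "'a \<Rightarrow> real"
  assumes "prob_space M" "integrable M (\<lambda>\<omega>. exp (X \<omega>))" "\<And>\<omega>. 0 \<le> X \<omega>"
  shows "1 \<le> (\<integral>\<omega>. exp (X \<omega>) \<partial>M)"
proof -
  interpret prob_space M by fact
  have "(\<integral>\<omega>. 1 \<partial>M) \<le> (\<integral>\<omega>. exp (X \<omega>) \<partial>M)"
    using assms by (intro integral_mono) auto
  then show ?thesis by (simp add: prob_space)
qed

text \<open>The function is a pointwise limit of convex ones: the mesh \<open>\<delta> n\<close>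
  gives the sampled function the constant \<open>c * \<delta> n\<close>, so the cubic correction
  carries the factor \<open>Suc n * (c * \<delta> n) ^ 4\<close>, which is of order
  \<open>1 / n\<close>.\<close>

lemma convex_on_log_exp_mean_lipschitz:
  fixes \<Psi> :: "real \<Rightarrow> real"
  assumes M: "prob_space M" "distributed M lborel z std_normal_density" and \<sigma>: "0 < \<sigma>"
    and growth: "moderate_growth M z \<Psi> h \<sigma>"
    and \<Psi>0: "\<Psi> 0 = 0" and nonneg: "\<And>x. 0 \<le> \<Psi> x"
    and conv: "convex_on UNIV \<Psi>" and sym: "\<And>x. \<Psi> (- x) = \<Psi> x"
    and lip: "\<And>x y. \<bar>\<Psi> x - \<Psi> y\<bar> \<le> c * \<bar>x - y\<bar>"
  shows "convex_on {0..} (log_exp_mean M z \<Psi> h \<sigma>)"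
proof (rule convex_on_tendsto)
  define \<delta> where "\<delta> n = \<sigma> / sqrt (real (Suc n))" for n
  define j where "j n = \<lfloor>h / \<delta> n\<rfloor>" for n
  define g where "g n i = \<Psi> (\<delta> n * real_of_int i)" for n i
  let ?w = "\<lambda>n. walk_log_mean (Suc n) (g n) (j n)"
  let ?r = "\<lambda>n m. Suc n * (c * \<delta> n) ^ 4 * m ^ 3 / 6"
  have \<delta>: "0 < \<delta> n" for n
    using \<sigma> by (simp add: \<delta>_def)
  have "0 \<le> c"
    using lip[of 1 0] abs_ge_zero[of "\<Psi> 1 - \<Psi> 0"] by simp
  have cont: "continuous_on UNIV \<Psi>"
    using conv by (intro convex_on_continuous) auto
  have "even_convex_lipschitz (g n) (c * \<delta> n)" for n
  proof
    fix i :: int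
    show "g n (- i) = g n i"
      by (simp add: g_def sym)
    have "\<Psi> ((1 - 1 / 2) *\<^sub>R (\<delta> n * (i + 1)) + (1 / 2) *\<^sub>R (\<delta> n * (i - 1)))
        \<le> (1 - 1 / 2) * \<Psi> (\<delta> n * (i + 1)) + (1 / 2) * \<Psi> (\<delta> n * (i - 1))"
      by (intro convex_onD[OF conv]) auto
    then show "2 * g n i \<le> g n (i + 1) + g n (i - 1)"
      by (simp add: g_def field_simps)
    show "\<bar>g n (i + 1) - g n i\<bar> \<le> c * \<delta> n"
      using lip[of "\<delta> n * (i + 1)" "\<delta> n * i"] \<delta>[of n] by (simp add: g_def algebra_simps)
  qed
  then show "convex_on {0..} (\<lambda>m. ?w n m + ?r n m)" for n
    by (rule convex_on_walk_log_mean)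
  fix m :: real assume "m \<in> {0..}"
  then have m: "0 \<le> m" by simp
  have le: "\<Psi> x \<le> c * \<bar>x\<bar>" for x
    using lip[of x 0] by (simp add: \<Psi>0)
  have exp_int: "integrable M (\<lambda>\<omega>. exp (s * \<Psi> (h + \<sigma> * z \<omega>)))" if "0 \<le> s" for s
    using growth that by (simp add: moderate_growth_def)
  have [measurable]: "\<Psi> \<in> borel_measurable borel" "z \<in> borel_measurable M"
    using cont distributed_measurable[OF M(2)] by (auto intro: borel_measurable_continuous_onI)
  have "(\<lambda>n. ?w n m) \<longlonglongrightarrow> log_exp_mean M z \<Psi> h \<sigma> m"
  proof (cases "m = 0")
    case True
    \<comment> \<open>The quadratic term of the exponential series turns the exponential moment at 1
      into the required second moment.\<close>
    have sq: "\<Psi> x ^ 2 \<le> 2 * exp (\<Psi> x)" for x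
      using exp_lower_Taylor_quadratic[OF nonneg[of x]] nonneg[of x] by simp
    have "(\<lambda>n. walk_mean (Suc n) (g n) (j n)) \<longlonglongrightarrow> (\<integral>\<omega>. \<Psi> (h + \<sigma> * z \<omega>) \<partial>M)"
      unfolding g_def j_def \<delta>_def
    proof (rule walk_mean_tendsto_gaussian[OF M \<sigma> cont nonneg \<open>0 \<le> c\<close>])
      show "\<Psi> x ^ 2 \<le> 2 * exp (c * \<bar>x\<bar>)" for x
        using sq[of x] le[of x] by (smt (verit) exp_le_cancel_iff)
      show "integrable M (\<lambda>\<omega>. \<Psi> (h + \<sigma> * z \<omega>) ^ 2)"
        by (rule Bochner_Integration.integrable_bound[OF integrable_mult_right[OF exp_int[of 1], of 2]])
          (use sq in auto)
    qed
    then show ?thesis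
      by (simp add: True walk_log_mean_def log_exp_mean_def del: walk_mean.simps)
  next
    case False
    \<comment> \<open>The second moment needed here is the exponential moment at
      \<open>2 * m\<close>.\<close>
    have sq: "exp (m * \<Psi> x) ^ 2 = exp (2 * m * \<Psi> x)" for x
      by (simp flip: exp_of_nat_mult)
    have "(\<lambda>n. walk_mean (Suc n) (\<lambda>i. exp (m * g n i)) (j n)) \<longlonglongrightarrow> (\<integral>\<omega>. exp (m * \<Psi> (h + \<sigma> * z \<omega>)) \<partial>M)"
      unfolding g_def j_def \<delta>_def
    proof (rule walk_mean_tendsto_gaussian[OF M \<sigma>, where f = "\<lambda>x. exp (m * \<Psi> x)"])
      show "0 \<le> 2 * m * c"
        using m \<open>0 \<le> c\<close> by simp
      show "exp (m * \<Psi> x) ^ 2 \<le> 1 * exp (2 * m * c * \<bar>x\<bar>)" for x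
        unfolding sq using mult_left_mono[OF le[of x], of "2 * m"] m by (simp add: mult.assoc)
      show "integrable M (\<lambda>\<omega>. exp (m * \<Psi> (h + \<sigma> * z \<omega>)) ^ 2)"
        unfolding sq using m by (intro exp_int) simp
    qed (auto intro!: continuous_intros cont)
    moreover have "1 \<le> (\<integral>\<omega>. exp (m * \<Psi> (h + \<sigma> * z \<omega>)) \<partial>M)"
      using m nonneg by (intro expectation_exp_ge_1 M exp_int) auto
    ultimately show ?thesis
      using False unfolding walk_log_mean_def log_exp_mean_def
      by (auto intro!: tendsto_intros simp del: walk_mean.simps)
  qed
  moreover have "(\<lambda>n. ?r n m) \<longlonglongrightarrow> 0"
  proof -
    have "(\<lambda>n. real (Suc n) * (1 / sqrt (real (Suc n))) ^ 4) \<longlonglongrightarrow> 0"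
      by real_asymp
    from tendsto_mult_left[OF this, of "(c * \<sigma>) ^ 4 * m ^ 3 / 6"] show ?thesis
      by (simp add: \<delta>_def power_mult_distrib power_divide mult_ac)
  qed
  ultimately show "(\<lambda>n. ?w n m + ?r n m) \<longlonglongrightarrow> log_exp_mean M z \<Psi> h \<sigma> m"
    using tendsto_add by fastforce
qed

text \<open>Restricting the points of tangency to \<open>[-N, N]\<close> bounds the slopes, and
  hence gives a Lipschitz function, without changing a differentiable convex \<Phi> on that
  interval.\<close>

definition tangent_sup :: "(real \<Rightarrow> real) \<Rightarrow> nat \<Rightarrow> real \<Rightarrow> real" where
  "tangent_sup \<Phi> N x = (SUP t\<in>{- real N..real N}. \<Phi> t + deriv \<Phi> t * (x - t))"

context
  fixes \<Phi> :: "real \<Rightarrow> real"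
  assumes diff: "\<Phi> differentiable_on UNIV" and conv: "convex_on UNIV \<Phi>"
    and sym: "\<And>x. \<Phi> (- x) = \<Phi> x"
begin

lemma has_deriv: "(\<Phi> has_real_derivative deriv \<Phi> x) (at x)"
  using diff by (simp add: differentiable_on_def DERIV_deriv_iff_real_differentiable)

lemma deriv_minus: "deriv \<Phi> (- x) = - deriv \<Phi> x"
proof -
  have "((\<lambda>x. \<Phi> (- x)) has_real_derivative - deriv \<Phi> (- x)) (at x)"
    using has_deriv[of "- x"] by (simp add: DERIV_mirror)
  then have "(\<Phi> has_real_derivative - deriv \<Phi> (- x)) (at x)"
    by (simp add: sym)
  with has_deriv[of x] show ?thesis
    using DERIV_unique by fastforce
qed

lemma tangent_le: "\<Phi> t + deriv \<Phi> t * (x - t) \<le> \<Phi> x"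
  using convex_on_imp_above_tangent[OF conv, of t x "deriv \<Phi> t"] has_deriv[of t] by simp

lemma bdd_above_tangent: "bdd_above ((\<lambda>t. \<Phi> t + deriv \<Phi> t * (x - t)) ` A)"
  using tangent_le by (auto intro!: bdd_aboveI[of _ "\<Phi> x"])

lemma tangent_le_tangent_sup:
  "\<bar>t\<bar> \<le> real N \<Longrightarrow> \<Phi> t + deriv \<Phi> t * (x - t) \<le> tangent_sup \<Phi> N x"
  unfolding tangent_sup_def by (intro cSUP_upper bdd_above_tangent) auto

lemma tangent_sup_leI:
  "(\<And>t. \<bar>t\<bar> \<le> real N \<Longrightarrow> \<Phi> t + deriv \<Phi> t * (x - t) \<le> B) \<Longrightarrow> tangent_sup \<Phi> N x \<le> B"
  unfolding tangent_sup_def by (intro cSUP_least) auto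

lemma tangent_sup_le: "tangent_sup \<Phi> N x \<le> \<Phi> x"
  by (intro tangent_sup_leI tangent_le)

lemma tangent_sup_eq: "\<bar>x\<bar> \<le> real N \<Longrightarrow> tangent_sup \<Phi> N x = \<Phi> x"
  using tangent_le_tangent_sup[of x N x] tangent_sup_le[of N x] by simp

text \<open>The derivative is odd, so the tangent at 0 is horizontal.\<close>

lemma tangent_sup_ge: "\<Phi> 0 \<le> tangent_sup \<Phi> N x"
  using tangent_le_tangent_sup[of 0 N x] deriv_minus[of 0] by simp

text \<open>Reflection exchanges the tangents at \<open>t\<close> and \<open>- t\<close>.\<close>

lemma tangent_sup_minus: "tangent_sup \<Phi> N (- x) = tangent_sup \<Phi> N x"
proof -
  have *: "tangent_sup \<Phi> N (- x) \<le> tangent_sup \<Phi> N x" for x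
  proof (rule tangent_sup_leI)
    fix t assume "\<bar>t\<bar> \<le> real N"
    then show "\<Phi> t + deriv \<Phi> t * (- x - t) \<le> tangent_sup \<Phi> N x"
      using tangent_le_tangent_sup[of "- t" N x] by (simp add: sym deriv_minus algebra_simps)
  qed
  from *[of x] *[of "- x"] show ?thesis by simp
qed

lemma convex_on_tangent_sup: "convex_on UNIV (tangent_sup \<Phi> N)"
proof (rule convex_onI)
  fix u x y :: real assume u: "0 < u" "u < 1"
  show "tangent_sup \<Phi> N ((1 - u) *\<^sub>R x + u *\<^sub>R y) \<le> (1 - u) * tangent_sup \<Phi> N x + u * tangent_sup \<Phi> N y"
  proof (rule tangent_sup_leI)
    fix t assume t: "\<bar>t\<bar> \<le> real N"
    have "\<Phi> t + deriv \<Phi> t * ((1 - u) *\<^sub>R x + u *\<^sub>R y - t) =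
        (1 - u) * (\<Phi> t + deriv \<Phi> t * (x - t)) + u * (\<Phi> t + deriv \<Phi> t * (y - t))"
      by (simp add: algebra_simps)
    also have "\<dots> \<le> (1 - u) * tangent_sup \<Phi> N x + u * tangent_sup \<Phi> N y"
      using u by (intro add_mono mult_left_mono tangent_le_tangent_sup[OF t]) auto
    finally show "\<Phi> t + deriv \<Phi> t * ((1 - u) *\<^sub>R x + u *\<^sub>R y - t)
      \<le> (1 - u) * tangent_sup \<Phi> N x + u * tangent_sup \<Phi> N y" .
  qed
qed simp

lemma tangent_sup_lipschitz: "\<exists>c. \<forall>x y. \<bar>tangent_sup \<Phi> N x - tangent_sup \<Phi> N y\<bar> \<le> c * \<bar>x - y\<bar>"
proof -
  have "continuous_on {- real (Suc N)..real (Suc N)} \<Phi>"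
    using differentiable_imp_continuous_on[OF diff] by (rule continuous_on_subset) simp
  then have "bounded (\<Phi> ` {- real (Suc N)..real (Suc N)})"
    by (intro compact_imp_bounded compact_continuous_image) auto
  then obtain B where "\<forall>x\<in>{- real (Suc N)..real (Suc N)}. \<bar>\<Phi> x\<bar> \<le> B"
    unfolding bounded_iff by auto
  then have B: "\<bar>\<Phi> x\<bar> \<le> B" if "\<bar>x\<bar> \<le> real (Suc N)" for x
    using that by (simp add: abs_le_iff)
  \<comment> \<open>The tangent at \<open>t\<close> lies below \<Phi> at \<open>t + 1\<close> and
    \<open>t - 1\<close>; this is why \<Phi> was bounded on an interval longer by 1 on each
    side.\<close>
  have slope: "\<bar>deriv \<Phi> t\<bar> \<le> 2 * B" if "\<bar>t\<bar> \<le> real N" for t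
  proof -
    have "\<bar>\<Phi> t\<bar> \<le> B" "\<bar>\<Phi> (t + 1)\<bar> \<le> B" "\<bar>\<Phi> (t - 1)\<bar> \<le> B"
      using that by (auto intro!: B)
    moreover have "\<Phi> t + deriv \<Phi> t \<le> \<Phi> (t + 1)" "\<Phi> t - deriv \<Phi> t \<le> \<Phi> (t - 1)"
      using tangent_le[of t "t + 1"] tangent_le[of t "t - 1"] by simp_all
    ultimately show ?thesis
      by linarith
  qed
  have *: "tangent_sup \<Phi> N x \<le> tangent_sup \<Phi> N y + 2 * B * \<bar>x - y\<bar>" for x y
  proof (rule tangent_sup_leI)
    fix t assume t: "\<bar>t\<bar> \<le> real N"
    have "deriv \<Phi> t * (x - y) \<le> \<bar>deriv \<Phi> t\<bar> * \<bar>x - y\<bar>"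
      by (metis abs_ge_self abs_mult)
    also have "\<dots> \<le> 2 * B * \<bar>x - y\<bar>"
      using slope[OF t] by (intro mult_right_mono) auto
    finally show "\<Phi> t + deriv \<Phi> t * (x - t) \<le> tangent_sup \<Phi> N y + 2 * B * \<bar>x - y\<bar>"
      using tangent_le_tangent_sup[OF t, of y] by (simp add: algebra_simps)
  qed
  show ?thesis
  proof (intro exI allI)
    fix x y
    show "\<bar>tangent_sup \<Phi> N x - tangent_sup \<Phi> N y\<bar> \<le> 2 * B * \<bar>x - y\<bar>"
      using *[of x y] *[of y x] by (simp add: abs_le_iff abs_minus_commute)
  qed
qed

lemma tangent_sup_tendsto: "(\<lambda>N. tangent_sup \<Phi> N x) \<longlonglongrightarrow> \<Phi> x"
proof (rule tendsto_eventually)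
  show "\<forall>\<^sub>F N in sequentially. tangent_sup \<Phi> N x = \<Phi> x"
    using eventually_ge_at_top[of "nat \<lceil>\<bar>x\<bar>\<rceil>"]
    by eventually_elim (auto intro!: tangent_sup_eq)
qed

end

section \<open>Removal of the Lipschitz condition by dominated convergence\<close>

theorem corollary1:
  fixes M :: "'a measure" and z :: "'a \<Rightarrow> real"
    and \<Phi> :: "real \<Rightarrow> real" and h \<sigma> :: real
  assumes "prob_space M"
    and "distributed M lborel z std_normal_density"
    and "\<sigma> > 0"
    and "smooth \<Phi>"
    and "moderate_growth M z \<Phi> h \<sigma>"
    and "\<Phi> 0 = 0"
    and "convex_on UNIV \<Phi>"
    and "\<And>x. \<Phi> (- x) = \<Phi> x"
  shows "convex_on {0..} (log_exp_mean M z \<Phi> h \<sigma>)"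
proof (rule convex_on_tendsto)
  have diff: "\<Phi> differentiable_on UNIV"
    using assms(4) unfolding smooth_def by (metis funpow_0)
  note ctx = diff assms(7,8)
  \<comment> \<open>The truncations lie between 0 and \<Phi>, so they inherit integrability from
    \<Phi>, which also dominates them in both limits below.\<close>
  define \<Psi> where "\<Psi> = tangent_sup \<Phi>"
  have \<Psi>_ge: "0 \<le> \<Psi> N x" and \<Psi>_le: "\<Psi> N x \<le> \<Phi> x" for N x
    using tangent_sup_ge[OF ctx, of N x] tangent_sup_le[OF ctx, of N x] assms(6)
    by (simp_all add: \<Psi>_def)
  have \<Phi>_ge: "0 \<le> \<Phi> x" for x
    using \<Psi>_ge \<Psi>_le order_trans by blast
  have \<Psi>_lim: "(\<lambda>N. \<Psi> N x) \<longlonglongrightarrow> \<Phi> x" for x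
    unfolding \<Psi>_def by (rule tangent_sup_tendsto[OF ctx])
  have \<Psi>_conv: "convex_on UNIV (\<Psi> N)" for N
    unfolding \<Psi>_def by (rule convex_on_tangent_sup[OF ctx])
  have \<Psi>_meas [measurable]: "\<Psi> N \<in> borel_measurable borel" for N
    using \<Psi>_conv by (intro borel_measurable_continuous_onI convex_on_continuous) auto
  have [measurable]: "\<Phi> \<in> borel_measurable borel" "z \<in> borel_measurable M"
    using differentiable_imp_continuous_on[OF diff] distributed_measurable[OF assms(2)]
    by (auto intro: borel_measurable_continuous_onI)
  have int: "integrable M (\<lambda>\<omega>. \<Phi> (h + \<sigma> * z \<omega>))"
    and exp_int: "0 \<le> m \<Longrightarrow> integrable M (\<lambda>\<omega>. exp (m * \<Phi> (h + \<sigma> * z \<omega>)))" for m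
    using assms(5) by (auto simp: moderate_growth_def)
  have exp_le: "exp (m * \<Psi> N x) \<le> exp (m * \<Phi> x)" if "0 \<le> m" for m N x
    using that \<Psi>_le by (simp add: mult_left_mono)
  show "convex_on {0..} (log_exp_mean M z (\<Psi> N) h \<sigma>)" for N
  proof -
    obtain c where "\<bar>\<Psi> N x - \<Psi> N y\<bar> \<le> c * \<bar>x - y\<bar>" for x y
      using tangent_sup_lipschitz[OF ctx, of N] unfolding \<Psi>_def by blast
    moreover have "\<Psi> N (- x) = \<Psi> N x" for x
      unfolding \<Psi>_def by (rule tangent_sup_minus[OF ctx])
    moreover have "\<Psi> N 0 = 0"
      using \<Psi>_ge[of N 0] \<Psi>_le[of N 0] assms(6) by simp
    moreover have "moderate_growth M z (\<Psi> N) h \<sigma>"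
      unfolding moderate_growth_def
    proof (intro conjI allI impI)
      show "integrable M (\<lambda>\<omega>. \<Psi> N (h + \<sigma> * z \<omega>))"
        by (rule Bochner_Integration.integrable_bound[OF int]) (use \<Psi>_ge \<Psi>_le \<Phi>_ge in auto)
      show "integrable M (\<lambda>\<omega>. exp (m * \<Psi> N (h + \<sigma> * z \<omega>)))" if "0 \<le> m" for m
        by (rule Bochner_Integration.integrable_bound[OF exp_int[OF that]]) (use exp_le[OF that] in auto)
    qed
    ultimately show ?thesis
      using assms(1-3) \<Psi>_ge \<Psi>_conv by (intro convex_on_log_exp_mean_lipschitz) auto
  qed
  fix m :: real assume "m \<in> {0..}"
  then have m: "0 \<le> m" by simp
  show "(\<lambda>N. log_exp_mean M z (\<Psi> N) h \<sigma> m) \<longlonglongrightarrow> log_exp_mean M z \<Phi> h \<sigma> m"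
  proof (cases "m = 0")
    case True
    have "(\<lambda>N. \<integral>\<omega>. \<Psi> N (h + \<sigma> * z \<omega>) \<partial>M) \<longlonglongrightarrow> (\<integral>\<omega>. \<Phi> (h + \<sigma> * z \<omega>) \<partial>M)"
      by (rule integral_dominated_convergence[where w = "\<lambda>\<omega>. \<Phi> (h + \<sigma> * z \<omega>)"])
        (use \<Psi>_ge \<Psi>_le \<Psi>_lim int in auto)
    with True show ?thesis
      by (simp add: log_exp_mean_def)
  next
    case False
    have "(\<lambda>N. \<integral>\<omega>. exp (m * \<Psi> N (h + \<sigma> * z \<omega>)) \<partial>M) \<longlonglongrightarrow> (\<integral>\<omega>. exp (m * \<Phi> (h + \<sigma> * z \<omega>)) \<partial>M)"
      by (rule integral_dominated_convergence[where w = "\<lambda>\<omega>. exp (m * \<Phi> (h + \<sigma> * z \<omega>))"])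
        (use exp_le[OF m] exp_int[OF m] \<Psi>_lim in \<open>auto intro!: tendsto_intros\<close>)
    moreover have "1 \<le> (\<integral>\<omega>. exp (m * \<Phi> (h + \<sigma> * z \<omega>)) \<partial>M)"
      using m \<Phi>_ge by (intro expectation_exp_ge_1 assms(1) exp_int) auto
    ultimately show ?thesis
      using False unfolding log_exp_mean_def by (auto intro!: tendsto_intros)
  qed
qed

end
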